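(* Let $b \ge 2$ be an integer and let $x \ge 1$ be a real number. The type III base $b$ continued logarithm for $x$ converges to $x$. That is, if the type III base $b$ continued logarithm of $x$ terminates, then its value (as a finite continued fraction) equals $x$; and if it does not terminate, then its sequence of convergents $(x_n)_{n\ge 0}$ satisfies $\lim_{n\to\infty} x_n = x$.
   Context: Fix an integer base $b\ge 2$. For real $\alpha\ge 1$, the type III base $b$ continued logarithm for $\alpha$ is defined by the recursion $y_0=\alpha$, and for $n\ge 0$: $a_n=\lfloor \log_b y_n\rfloor$, $c_n=\lfloor y_n/b^{a_n}\rfloor$; if $y_n=c_nb^{a_n}$ the process terminates at the term $c_nb^{a_n}$; otherwise $y_{n+1}=\dfrac{b^{a_n}}{y_n-c_nb^{a_n}}$. (Thus $a_n\in\mathbb{Z}_{\ge 0}$ and $c_n\in\{1,\dots,b-1\}$.) The associated continued fraction is $$c_0b^{a_0}+\cfrac{b^{a_0}}{c_1b^{a_1}+\cfrac{b^{a_1}}{c_2b^{a_2}+\cfrac{b^{a_2}}{c_3b^{a_3}+\cdots}}},$$ a finite continued fraction ending with the denominator $c_nb^{a_n}$ if the process terminates at index $n$. Its $n$th convergent $x_n$ is the finite continued fraction obtained by truncating after the denominator $c_nb^{a_n}$. *)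

theory Defs
  imports "HOL-Analysis.Analysis"
begin

definition clog3_exponent :: "nat \<Rightarrow> real \<Rightarrow> int" where
  "clog3_exponent b y = \<lfloor>log (real b) y\<rfloor>"

definition clog3_digit :: "nat \<Rightarrow> real \<Rightarrow> int" where
  "clog3_digit b y = \<lfloor>y / real b powi clog3_exponent b y\<rfloor>"

definition clog3_term :: "nat \<Rightarrow> real \<Rightarrow> real" where
  "clog3_term b y = of_int (clog3_digit b y) * real b powi clog3_exponent b y"

(* The complete quotients y_n. The recursion is total: once the process has terminated, the
   denominator below vanishes and the later values are meaningless (y / 0 = 0). *)
primrec clog3_y :: "nat \<Rightarrow> real \<Rightarrow> nat \<Rightarrow> real" where
  "clog3_y b x 0 = x"
| "clog3_y b x (Suc n) =
     real b powi clog3_exponent b (clog3_y b x n) / (clog3_y b x n - clog3_term b (clog3_y b x n))"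

definition clog3_a :: "nat \<Rightarrow> real \<Rightarrow> nat \<Rightarrow> int" where
  "clog3_a b x n = clog3_exponent b (clog3_y b x n)"

definition clog3_c :: "nat \<Rightarrow> real \<Rightarrow> nat \<Rightarrow> int" where
  "clog3_c b x n = clog3_digit b (clog3_y b x n)"

(* n is the first index with y_n = c_n b^(a_n); minimality excludes the meaningless indices
   after termination, where this equation holds as 0 = 0. *)
definition clog3_terminates_at :: "nat \<Rightarrow> real \<Rightarrow> nat \<Rightarrow> bool" where
  "clog3_terminates_at b x n \<longleftrightarrow>
     clog3_y b x n = of_int (clog3_c b x n) * real b powi clog3_a b x n \<and>
     (\<forall>m<n. clog3_y b x m \<noteq> of_int (clog3_c b x m) * real b powi clog3_a b x m)"

definition clog3_terminates :: "nat \<Rightarrow> real \<Rightarrow> bool" where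
  "clog3_terminates b x \<longleftrightarrow> (\<exists>n. clog3_terminates_at b x n)"

(* cfrac_from p q i k = q i + p i / (q (i+1) + p (i+1) / (... + p (i+k-1) / q (i+k))) *)
primrec cfrac_from :: "(nat \<Rightarrow> real) \<Rightarrow> (nat \<Rightarrow> real) \<Rightarrow> nat \<Rightarrow> nat \<Rightarrow> real" where
  "cfrac_from p q i 0 = q i"
| "cfrac_from p q i (Suc k) = q i + p i / cfrac_from p q (Suc i) k"

(* The truncation after the denominator c_n b^(a_n); if the process terminates at index n, this is
   the value of the whole finite continued fraction. *)
definition clog3_convergent :: "nat \<Rightarrow> real \<Rightarrow> nat \<Rightarrow> real" where
  "clog3_convergent b x n =
     cfrac_from (\<lambda>i. real b powi clog3_a b x i)
                (\<lambda>i. of_int (clog3_c b x i) * real b powi clog3_a b x i) 0 n"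

end

theory Submission
  imports Defs
begin

text \<open>
  The complete quotients satisfy \<open>y\<^sub>i = c\<^sub>i b\<^bsup>a\<^sub>i\<^esup> + b\<^bsup>a\<^sub>i\<^esup> / y\<^sub>i\<^sub>+\<^sub>1\<close>. If \<open>K\<close> is a truncation of the
  continued fraction starting at index \<open>i\<close> and \<open>K'\<close> its tail starting at index \<open>i + 1\<close>, then
  the relative errors \<open>e = \<bar>K - y\<^sub>i\<bar> / y\<^sub>i\<close> and \<open>e' = \<bar>K' - y\<^sub>i\<^sub>+\<^sub>1\<bar> / y\<^sub>i\<^sub>+\<^sub>1\<close> satisfy
  \<open>e = b\<^bsup>a\<^sub>i\<^esup> / (y\<^sub>i K') * e'\<close>. The factor is at most \<open>b / (b + 1)\<close>: for \<open>y\<^sub>i\<^sub>+\<^sub>1 < b\<close> because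
  \<open>y\<^sub>i\<close> exceeds \<open>b\<^bsup>a\<^sub>i\<^esup>\<close> by at least \<open>b\<^bsup>a\<^sub>i\<^esup> / b\<close>, and for \<open>y\<^sub>i\<^sub>+\<^sub>1 \<ge> b\<close> because then \<open>K' \<ge> b\<close>.
  So the truncations converge geometrically.
\<close>

lemma clog3_exponent_nonneg:
  assumes "b \<ge> 2" "y \<ge> 1"
  shows "clog3_exponent b y \<ge> 0"
  using assms by (simp add: clog3_exponent_def)

lemma clog3_power_ge_1:
  assumes "b \<ge> 2" "y \<ge> 1"
  shows "real b powi clog3_exponent b y \<ge> 1"
  using assms clog3_exponent_nonneg[OF assms] by (intro one_le_power_int) auto

lemma clog3_power_le:
  assumes "b \<ge> 2" "y \<ge> 1"
  shows "real b powi clog3_exponent b y \<le> y"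
proof -
  have "real b powr real_of_int (clog3_exponent b y) \<le> real b powr log (real b) y"
    using assms by (intro powr_mono) (auto simp: clog3_exponent_def)
  then show ?thesis
    using assms by (simp add: powr_real_of_int')
qed

lemma clog3_digit_ge_1:
  assumes "b \<ge> 2" "y \<ge> 1"
  shows "clog3_digit b y \<ge> 1"
  using clog3_power_ge_1[OF assms] clog3_power_le[OF assms]
  by (simp add: clog3_digit_def le_floor_iff field_simps)

lemma clog3_power_le_term:
  assumes "b \<ge> 2" "y \<ge> 1"
  shows "real b powi clog3_exponent b y \<le> clog3_term b y"
  using clog3_power_ge_1[OF assms] clog3_digit_ge_1[OF assms]
  unfolding clog3_term_def by (intro mult_le_cancel_right1[THEN iffD2]) auto

lemma clog3_term_le:
  assumes "b \<ge> 2" "y \<ge> 1"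
  shows "clog3_term b y \<le> y"
proof -
  have "real_of_int (clog3_digit b y) \<le> y / real b powi clog3_exponent b y"
    by (simp add: clog3_digit_def)
  then show ?thesis
    using clog3_power_ge_1[OF assms] by (simp add: clog3_term_def pos_le_divide_eq)
qed

lemma clog3_less_term_plus_power:
  assumes "b \<ge> 2" "y \<ge> 1"
  shows "y < clog3_term b y + real b powi clog3_exponent b y"
proof -
  have "y / real b powi clog3_exponent b y < real_of_int (clog3_digit b y) + 1"
    by (simp add: clog3_digit_def)
  then show ?thesis
    using clog3_power_ge_1[OF assms] by (simp add: clog3_term_def pos_divide_less_eq algebra_simps)
qed

text \<open>For \<open>y \<ge> b\<close> the exponent is at least 1. This gives the bound
  \<open>K' \<ge> b\<close> in the case of a large next quotient.\<close>

lemma base_le_clog3_term: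
  assumes "b \<ge> 2" "y \<ge> real b"
  shows "clog3_term b y \<ge> real b"
proof -
  have y: "y \<ge> 1" using assms by simp
  have "clog3_exponent b y \<ge> 1"
    using assms y by (simp add: clog3_exponent_def le_floor_iff le_log_iff)
  then have "real b powi 1 \<le> real b powi clog3_exponent b y"
    using assms by (intro power_int_increasing) auto
  then show ?thesis
    using clog3_power_le_term[OF assms(1) y] by simp
qed

text \<open>As long as the process has not stopped, the remainder lies strictly between 0 and the
  power in the numerator, so the next quotient exceeds 1.\<close>

lemma clog3_y_ge_1:
  assumes "b \<ge> 2" "x \<ge> 1" "\<And>m. m < n \<Longrightarrow> clog3_y b x m \<noteq> clog3_term b (clog3_y b x m)"
  shows "clog3_y b x n \<ge> 1"
  using assms(3)
proof (induction n)
  case (Suc n)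
  let ?y = "clog3_y b x n"
  have y: "?y \<ge> 1" using Suc by simp
  have "clog3_term b ?y < ?y"
    using clog3_term_le[OF assms(1) y] Suc.prems[of n] by simp
  then show ?case
    using clog3_less_term_plus_power[OF assms(1) y] by (simp add: le_divide_eq)
qed (use assms in simp)

lemma clog3_y_eq:
  assumes "b \<ge> 2" "clog3_y b x n \<noteq> clog3_term b (clog3_y b x n)"
  shows "clog3_y b x n =
    clog3_term b (clog3_y b x n) + real b powi clog3_exponent b (clog3_y b x n) / clog3_y b x (Suc n)"
  using assms by simp

text \<open>The start index is free because \<open>cfrac_from\<close> unfolds at the front:
  inductions on the length pass from \<open>i\<close> to \<open>Suc i\<close>.\<close>

abbreviation clog3_tail :: "nat \<Rightarrow> real \<Rightarrow> nat \<Rightarrow> nat \<Rightarrow> real" where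
  "clog3_tail b x \<equiv> cfrac_from (\<lambda>i. real b powi clog3_exponent b (clog3_y b x i))
    (\<lambda>i. clog3_term b (clog3_y b x i))"

lemma clog3_convergent_eq_tail: "clog3_convergent b x n = clog3_tail b x 0 n"
  by (simp add: clog3_convergent_def clog3_a_def clog3_c_def clog3_term_def)

lemma clog3_terminates_at_iff:
  "clog3_terminates_at b x n \<longleftrightarrow>
    clog3_y b x n = clog3_term b (clog3_y b x n) \<and>
    (\<forall>m<n. clog3_y b x m \<noteq> clog3_term b (clog3_y b x m))"
  by (simp only: clog3_terminates_at_def clog3_a_def clog3_c_def clog3_term_def)

text \<open>At the terminating index the last denominator is the complete quotient itself; each
  earlier level inverts one step of the recursion.\<close>

lemma clog3_tail_eq:
  assumes "b \<ge> 2"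
    and "\<And>m. m < i + k \<Longrightarrow> clog3_y b x m \<noteq> clog3_term b (clog3_y b x m)"
    and "clog3_y b x (i + k) = clog3_term b (clog3_y b x (i + k))"
  shows "clog3_tail b x i k = clog3_y b x i"
  using assms(2,3)
proof (induction k arbitrary: i)
  case (Suc k)
  have "clog3_tail b x (Suc i) k = clog3_y b x (Suc i)"
    by (rule Suc.IH) (unfold add_Suc_shift, fact Suc.prems(1), fact Suc.prems(2))
  then show ?case
    using clog3_y_eq[OF assms(1), of x i] Suc.prems(1)[of i] by simp
qed (simp only: cfrac_from.simps add_0_right)

text \<open>What follows the leading term is a positive power over a tail that is nonnegative by
  induction.\<close>

lemma clog3_term_le_tail:
  assumes "b \<ge> 2" "x \<ge> 1"
    and "\<And>m. m < i + k \<Longrightarrow> clog3_y b x m \<noteq> clog3_term b (clog3_y b x m)"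
  shows "clog3_term b (clog3_y b x i) \<le> clog3_tail b x i k"
  using assms(3)
proof (induction k arbitrary: i)
  case (Suc k)
  have "clog3_y b x (Suc i) \<ge> 1"
    using Suc.prems by (intro clog3_y_ge_1 assms(1,2)) auto
  from clog3_power_ge_1[OF assms(1) this] clog3_power_le_term[OF assms(1) this]
  have "0 \<le> clog3_term b (clog3_y b x (Suc i))"
    by simp
  also have "\<dots> \<le> clog3_tail b x (Suc i) k"
    using Suc.prems by (intro Suc.IH) auto
  finally show ?case by simp
qed simp

lemma clog3_tail_error:
  assumes b: "b \<ge> 2" and x: "x \<ge> 1"
    and "\<And>m. m < i + k \<Longrightarrow> clog3_y b x m \<noteq> clog3_term b (clog3_y b x m)"
  shows "\<bar>clog3_tail b x i k - clog3_y b x i\<bar> \<le> clog3_y b x i * (real b / (real b + 1)) ^ k"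
  using assms(3)
proof (induction k arbitrary: i)
  case 0
  have y: "clog3_y b x i \<ge> 1"
    using 0 by (intro clog3_y_ge_1 b x) auto
  \<comment> \<open>The truncation is the leading term, which lies between 0 and \<open>y\<close>,
    so the relative error starts at no more than 1.\<close>
  show ?case
    using clog3_term_le[OF b y] clog3_power_le_term[OF b y] clog3_power_ge_1[OF b y] by simp
next
  case (Suc k)
  let ?r = "real b / (real b + 1)"
  define y where "y = clog3_y b x i"
  define y' where "y' = clog3_y b x (Suc i)"
  define K' where "K' = clog3_tail b x (Suc i) k"
  define p where "p = real b powi clog3_exponent b y"
  define q where "q = clog3_term b y"
  have y: "y \<ge> 1" unfolding y_def
    using Suc.prems by (intro clog3_y_ge_1 b x) auto
  have y': "y' \<ge> 1" unfolding y'_def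
    using Suc.prems by (intro clog3_y_ge_1 b x) auto
  have K': "clog3_term b y' \<le> K'" unfolding y'_def K'_def
    using Suc.prems by (intro clog3_term_le_tail b x) auto
  have K'1: "K' \<ge> 1"
    using K' clog3_power_ge_1[OF b y'] clog3_power_le_term[OF b y'] by simp
  have p: "p \<ge> 1" and pq: "p \<le> q"
    unfolding p_def q_def by (fact clog3_power_ge_1[OF b y] clog3_power_le_term[OF b y])+
  have y_eq: "y = q + p / y'"
    unfolding y_def y'_def p_def q_def
    by (rule clog3_y_eq[OF b]) (use Suc.prems in auto)
  have IH: "\<bar>K' - y'\<bar> \<le> y' * ?r ^ k"
    unfolding K'_def y'_def using Suc.prems by (intro Suc.IH) auto
  have factor: "p / K' \<le> y * ?r"
  proof (cases "y' \<ge> real b")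
    case True
    then have "K' \<ge> real b"
      using K' base_le_clog3_term[OF b True] by simp
    then have "p / K' \<le> p / real b"
      using p b by (intro divide_left_mono) auto
    also have "\<dots> \<le> p * ?r"
    proof -
      \<comment> \<open>Cleared of denominators, \<open>1 / b \<le> ?r\<close> reads
        \<open>b + 1 \<le> b * b\<close>.\<close>
      have "real b + 1 \<le> 2 * real b" "2 * real b \<le> real b * real b" using b by auto
      then have "1 + real b \<le> real b * real b" by linarith
      then have "1 / real b \<le> ?r" using b by (simp add: field_simps)
      then show ?thesis using mult_left_mono[of "1 / real b" ?r p] p by simp
    qed
    also have "\<dots> \<le> y * ?r"
    proof (rule mult_right_mono)
      have "p / y' \<ge> 0" using p y' by simp
      then show "p \<le> y" using y_eq pq by linarith
    qed simp
    finally show ?thesis .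
  next
    case False
    have "p / real b \<le> p / y'"
      using False p y' by (intro divide_left_mono) auto
    then have "p + p / real b \<le> y"
      using y_eq pq by simp
    then have "(p + p / real b) * ?r \<le> y * ?r"
      by (intro mult_right_mono) auto
    \<comment> \<open>The ratio \<open>?r\<close> is chosen as the reciprocal of
      \<open>1 + 1 / b\<close>; with it, \<open>K' \<ge> 1\<close> is enough in this case.\<close>
    moreover have "(p + p / real b) * ?r = p"
      using b by (simp add: divide_simps) (simp add: algebra_simps)
    moreover have "p / K' \<le> p"
      using p K'1 by (simp add: field_simps)
    ultimately show ?thesis by simp
  qed
  \<comment> \<open>Both sides share the leading term \<open>q\<close>, which cancels; the
    difference of reciprocals then exposes the relative error of the tail.\<close>
  have "clog3_tail b x i (Suc k) - y = p / K' - p / y'"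
    using y_eq by (simp add: K'_def p_def q_def y_def)
  also have "\<dots> = p / K' * ((y' - K') / y')"
    using K'1 y' by (simp add: field_simps)
  finally have "\<bar>clog3_tail b x i (Suc k) - y\<bar> = p / K' * (\<bar>K' - y'\<bar> / y')"
    using p K'1 y' by (simp add: abs_mult abs_minus_commute)
  also have "\<dots> \<le> y * ?r * ?r ^ k"
  proof (rule mult_mono)
    show "\<bar>K' - y'\<bar> / y' \<le> ?r ^ k"
      using IH y' by (simp only: pos_divide_le_eq mult.commute)
  qed (use factor p K'1 y y' in simp_all)
  finally show ?case
    by (simp add: y_def mult_ac)
qed

theorem theorem10:
  fixes b :: nat and x :: real
  assumes "b \<ge> 2" and "x \<ge> 1"
  shows "(\<forall>n. clog3_terminates_at b x n \<longrightarrow> clog3_convergent b x n = x) \<and>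
         (\<not> clog3_terminates b x \<longrightarrow> clog3_convergent b x \<longlonglongrightarrow> x)"
proof (intro conjI allI impI)
  fix n
  assume "clog3_terminates_at b x n"
  then have "clog3_tail b x 0 n = clog3_y b x 0"
    by (intro clog3_tail_eq[OF assms(1)]) (auto simp: clog3_terminates_at_iff)
  then show "clog3_convergent b x n = x"
    by (simp add: clog3_convergent_eq_tail)
next
  assume nt: "\<not> clog3_terminates b x"
  have ne: "clog3_y b x m \<noteq> clog3_term b (clog3_y b x m)" for m
  proof
    assume eq: "clog3_y b x m = clog3_term b (clog3_y b x m)"
    define P where "P n \<longleftrightarrow> clog3_y b x n = clog3_term b (clog3_y b x n)" for n
    have "P m" using eq by (simp only: P_def)
    \<comment> \<open>\<open>m\<close> need not be the first such index, but termination refers to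
      the first one.\<close>
    then obtain n where "P n \<and> (\<forall>k<n. \<not> P k)"
      using exists_least_iff[of P] by metis
    then have "clog3_terminates_at b x n"
      unfolding P_def clog3_terminates_at_iff .
    with nt show False by (auto simp: clog3_terminates_def)
  qed
  have "norm (clog3_convergent b x n - x) \<le> x * (real b / (real b + 1)) ^ n" for n
    using clog3_tail_error[OF assms ne, of 0 n] by (simp add: clog3_convergent_eq_tail)
  then have "\<forall>\<^sub>F n in sequentially.
      norm (clog3_convergent b x n - x) \<le> x * (real b / (real b + 1)) ^ n"
    by simp
  moreover have "(\<lambda>n. x * (real b / (real b + 1)) ^ n) \<longlonglongrightarrow> 0"
    by (intro tendsto_mult_right_zero LIMSEQ_power_zero) simp
  ultimately have "(\<lambda>n. clog3_convergent b x n - x) \<longlonglongrightarrow> 0"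
    by (rule Lim_null_comparison)
  then show "clog3_convergent b x \<longlonglongrightarrow> x"
    by (simp add: LIM_zero_iff)
qed

end
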